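(* Let $n\ge2$, $M\ge1$, $u_1,\dots,u_M\in[n-1]$ (repetitions allowed), and let the U-EquiStatic matrix $\widetilde W=\frac1{2M}\sum_{i=1}^M\big(A^{(u_i)}+[A^{(u_i)}]^T\big)$ have consensus rate $\rho$. Let $\eta\in(0,1)$, and let $\widetilde W^{(t)}$ be the random OU-EquiDyn matrix generated from $\eta$ and the basis index $\{u_i,-u_i\}_{i=1}^M$ by the one-peer undirected procedure described in the context. Then $$\mathbb{E}\big[\|\Pi\widetilde W^{(t)}x\|^2\big]\le\Big(1-\tfrac43\eta(1-\eta)(1-\rho)\Big)\|\Pi x\|^2\qquad\text{for all }x\in\mathbb{R}^n .$$
   Context: Notation: $[m]=\{1,\dots,m\}$; $\|\cdot\|$ is the Euclidean norm; $\mathbf 1_n$ is the all-ones vector; $J=\frac1n\mathbf 1_n\mathbf 1_n^T$ and $\Pi=I-J$. The operation $i\bmod n$ returns the representative of $i$ modulo $n$ lying in $\{1,\dots,n\}$. Basis matrices: for $u\in[n-1]$, $A^{(u)}=[a^{(u)}_{ij}]\in\mathbb{R}^{n\times n}$ is defined by $a^{(u)}_{ij}=\frac{n-1}{n}$ if $i=(j+u)\bmod n$, $a^{(u)}_{ij}=\frac1n$ if $i=j$, and $a^{(u)}_{ij}=0$ otherwise. Consensus rate: the consensus rate of a fixed matrix $W$ is the minimum $\rho\ge0$ such that $\|\Pi Wx\|\le\rho\|\Pi x\|$ for all $x\in\mathbb{R}^n$. One-peer undirected procedure (OU-EquiDyn): draw $v_t$ uniformly from the multiset $\{u_i,-u_i\}_{i=1}^M$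 and, independently, $s_t$ uniformly from $[n]$. Initialize $A=[a_{ij}]=I$ and flags $b_i=0$ for all $i\in[n]$. For $j$ running in order through $s_t,s_t+1,\dots,s_t+n-1$ (each reduced mod $n$): set $i=(j+v_t)\bmod n$; if $b_i=0$ and $b_j=0$, set $a_{ij}=a_{ji}=\frac{n-1}n$, $a_{ii}=a_{jj}=\frac1n$, and $b_i=b_j=1$; otherwise do nothing. Output $\widetilde W^{(t)}=(1-\eta)I+\eta A$. The expectation is over $(v_t,s_t)$. *)

theory Defs
  imports "HOL-Probability.Probability" "Jordan_Normal_Form.Matrix"
begin

text \<open>Nodes are the residues modulo \<open>n\<close>. Since matrix and vector indices start at 0, the
  representative taken is the one in \<open>{0..<n}\<close>, so that the node \<open>n\<close> of \<open>{1..n}\<close> has index 0.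
  Matrices and vectors have an explicit dimension \<open>n\<close> (\<open>carrier_mat n n\<close>, \<open>carrier_vec n\<close>).\<close>

definition avg_mat :: "nat \<Rightarrow> real mat" where
  "avg_mat n = mat n n (\<lambda>(i, j). 1 / real n)"

definition Pi_mat :: "nat \<Rightarrow> real mat" where
  "Pi_mat n = 1\<^sub>m n - avg_mat n"

definition euclid_norm :: "real vec \<Rightarrow> real" where
  "euclid_norm x = sqrt (\<Sum>i<dim_vec x. (vec_index x i)\<^sup>2)"

definition basis_mat :: "nat \<Rightarrow> nat \<Rightarrow> real mat" where
  "basis_mat n u = mat n n (\<lambda>(i, j).
     if i = (j + u) mod n then (real n - 1) / real n
     else if i = j then 1 / real n
     else 0)"

text \<open>The type of matrices of all dimensions is not an additive monoid, so the sum over the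
  basis index is taken entrywise.\<close>

definition u_equi_static :: "nat \<Rightarrow> nat \<Rightarrow> (nat \<Rightarrow> nat) \<Rightarrow> real mat" where
  "u_equi_static n M u = (1 / (2 * real M)) \<cdot>\<^sub>m
     mat n n (\<lambda>ij. \<Sum>m\<in>{1..M}. (basis_mat n (u m) + transpose_mat (basis_mat n (u m))) $$ ij)"

definition consensus_rate :: "nat \<Rightarrow> real mat \<Rightarrow> real" where
  "consensus_rate n W = (LEAST \<rho>. 0 \<le> \<rho> \<and>
     (\<forall>x\<in>carrier_vec n.
        euclid_norm (Pi_mat n *\<^sub>v (W *\<^sub>v x)) \<le> \<rho> * euclid_norm (Pi_mat n *\<^sub>v x)))"

text \<open>One pass of the loop body: the state is the matrix \<open>a\<close> under construction, as a function
  of the index pair, together with the flags \<open>b\<close>. The offset \<open>v\<close> may be negative.\<close>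

definition ou_step :: "nat \<Rightarrow> int \<Rightarrow> nat \<Rightarrow> (nat \<times> nat \<Rightarrow> real) \<times> (nat \<Rightarrow> bool)
    \<Rightarrow> (nat \<times> nat \<Rightarrow> real) \<times> (nat \<Rightarrow> bool)" where
  "ou_step n v j = (\<lambda>(a, b).
     let i = nat ((int j + v) mod int n) in
     if \<not> b i \<and> \<not> b j
     then (a((i, j) := (real n - 1) / real n, (j, i) := (real n - 1) / real n,
             (i, i) := 1 / real n, (j, j) := 1 / real n),
           b(i := True, j := True))
     else (a, b))"

definition ou_mat :: "nat \<Rightarrow> int \<Rightarrow> nat \<Rightarrow> real mat" where
  "ou_mat n v s = mat n n (fst (fold (ou_step n v) (map (\<lambda>k. (s + k) mod n) [0..<n])
     (\<lambda>(i, j). if i = j then 1 else 0, \<lambda>_. False)))"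

definition ou_equi_dyn :: "nat \<Rightarrow> real \<Rightarrow> int \<Rightarrow> nat \<Rightarrow> real mat" where
  "ou_equi_dyn n \<eta> v s = (1 - \<eta>) \<cdot>\<^sub>m 1\<^sub>m n + \<eta> \<cdot>\<^sub>m ou_mat n v s"

text \<open>Law of the matrix: the offset is uniform on the multiset, counting repetitions, of all
  \<open>u m\<close> and \<open>- u m\<close>, and is independent of the starting node.\<close>

definition basis_index :: "nat \<Rightarrow> (nat \<Rightarrow> nat) \<Rightarrow> int multiset" where
  "basis_index M u = image_mset (\<lambda>m. int (u m)) (mset_set {1..M})
                   + image_mset (\<lambda>m. - int (u m)) (mset_set {1..M})"

definition ou_equi_dyn_pmf :: "nat \<Rightarrow> nat \<Rightarrow> (nat \<Rightarrow> nat) \<Rightarrow> real \<Rightarrow> real mat pmf" where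
  "ou_equi_dyn_pmf n M u \<eta> =
     map_pmf (\<lambda>(v, s). ou_equi_dyn n \<eta> v s)
       (pair_pmf (pmf_of_multiset (basis_index M u)) (pmf_of_set {0..<n}))"

end

theory Submission
  imports Defs
begin

text \<open>With \<open>y = \<Pi> x\<close> and \<open>c = \<eta> (n - 1) / n\<close>, a run of the procedure that matches the pairs
  \<open>(p, p + v)\<close>, \<open>p \<in> P\<close>, has \<open>\<parallel>\<Pi> W x\<parallel>\<^sup>2 \<le> \<parallel>W y\<parallel>\<^sup>2 = \<parallel>y\<parallel>\<^sup>2 - 2 c (1 - c) (\<Sum>p\<in>P. (y p - y (p + v))\<^sup>2)\<close>,
  because the pairs are disjoint. Changing the starting node rotates \<open>P\<close>, so averaging over it
  replaces the sum by \<open>card P / n\<close> times the sum over all nodes; and \<open>card P \<ge> n / 3\<close>, since the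
  greedy matching is maximal: for every node \<open>j\<close>, one of \<open>j - v\<close>, \<open>j\<close>, \<open>j + v\<close> lies in \<open>P\<close>. The average over
  the offsets of the sums over all nodes is, up to the factor \<open>2 n / (n - 1)\<close>, the quadratic form of
  \<open>I - W\<close> for the static \<open>W\<close>, which is at least \<open>(1 - \<rho>) \<parallel>y\<parallel>\<^sup>2\<close> by the Cauchy-Schwarz inequality.\<close>

section \<open>Greedy pairing along a map\<close>

text \<open>\<open>P\<close> records only the proposing end \<open>j\<close> of each matched pair
  \<open>j\<close>, \<open>f j\<close>; the raised flags of the procedure are then \<open>P\<close>
  together with its image under \<open>f\<close>.\<close>

definition greedy_step :: "('a \<Rightarrow> 'a) \<Rightarrow> 'a \<Rightarrow> 'a set \<Rightarrow> 'a set" where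
  "greedy_step f j P = (if {j, f j} \<inter> (P \<union> f ` P) = {} then insert j P else P)"

lemma greedy_step_supset: "P \<subseteq> greedy_step f j P"
  by (auto simp: greedy_step_def)

lemma fold_greedy_supset: "P \<subseteq> fold (greedy_step f) js P"
proof (induction js arbitrary: P)
  case (Cons j js)
  show ?case using greedy_step_supset[of P f j] Cons[of "greedy_step f j P"] by simp
qed simp

text \<open>A scanned \<open>j\<close> is either blocked already or inserted on the spot, and by
  monotonicity no later step undoes this.\<close>

lemma fold_greedy_maximal:
  assumes "j \<in> set js"
  shows "{j, f j} \<inter> (fold (greedy_step f) js P \<union> f ` fold (greedy_step f) js P) \<noteq> {}"
  using assms
proof (induction js arbitrary: P)
  case (Cons i js)
  show ?case
  proof (cases "j = i")
    case True
    have "{j, f j} \<inter> (greedy_step f j P \<union> f ` greedy_step f j P) \<noteq> {}"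
      by (auto simp: greedy_step_def)
    with True show ?thesis
      using fold_greedy_supset[of "greedy_step f j P" f js] by auto
  next
    case False
    with Cons show ?thesis by simp
  qed
qed simp

lemma fold_greedy_subset:
  assumes "P \<subseteq> D" "set js \<subseteq> D"
  shows "fold (greedy_step f) js P \<subseteq> D"
  using assms by (induction js arbitrary: P) (auto simp: greedy_step_def)

text \<open>An inserted \<open>j\<close> and its partner both avoid \<open>P\<close> and its image,
  so the only possible new collision is \<open>f j = j\<close>, which the first assumption
  excludes.\<close>

lemma fold_greedy_matching:
  assumes "\<And>j. j \<in> set js \<Longrightarrow> f j \<noteq> j" "inj_on f P" "P \<inter> f ` P = {}"
  shows "inj_on f (fold (greedy_step f) js P) \<and>
    fold (greedy_step f) js P \<inter> f ` fold (greedy_step f) js P = {}"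
  using assms
proof (induction js arbitrary: P)
  case (Cons j js)
  have "inj_on f (greedy_step f j P)" "greedy_step f j P \<inter> f ` greedy_step f j P = {}"
    using Cons.prems(2,3) Cons.prems(1)[of j] by (auto simp: greedy_step_def)
  with Cons show ?case by simp
qed simp

text \<open>An injective map that commutes with \<open>f\<close> carries every blocking test over to
  the image, so the two runs take the same decisions. It serves below with \<open>g\<close> a
  rotation of the cycle.\<close>

lemma fold_greedy_equivariant:
  assumes "inj_on g D" "f ` D \<subseteq> D" "\<And>j. j \<in> D \<Longrightarrow> f (g j) = g (f j)"
    and "P \<subseteq> D" "set js \<subseteq> D"
  shows "fold (greedy_step f) (map g js) (g ` P) = g ` fold (greedy_step f) js P"
  using assms(4,5)
proof (induction js arbitrary: P)
  case (Cons j js)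
  have j: "j \<in> D" "f j \<in> D" using Cons.prems assms(2) by auto
  have "f ` P \<subseteq> D" using Cons.prems assms(2) by auto
  moreover have "f ` g ` P = g ` f ` P"
    using assms(3) Cons.prems(1) by (force simp: image_image)
  ultimately have "{g j, f (g j)} \<inter> (g ` P \<union> f ` g ` P) = g ` ({j, f j} \<inter> (P \<union> f ` P))"
    using inj_on_image_Int[OF assms(1), of "{j, f j}" "P \<union> f ` P"] j Cons.prems(1) assms(3)
    by (simp add: image_Un)
  hence "greedy_step f (g j) (g ` P) = g ` greedy_step f j P"
    by (auto simp: greedy_step_def)
  moreover have "greedy_step f j P \<subseteq> D" using Cons.prems by (auto simp: greedy_step_def)
  ultimately show ?case using Cons by simp
qed simp

text \<open>A blocked \<open>j\<close> lies in \<open>P\<close>, in its image or in its preimage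
  under \<open>f\<close>; each of these sets has at most \<open>card P\<close> elements. The 3 here
  ends up in the denominator of the constant 4/3.\<close>

lemma card_maximal_matching:
  assumes "finite D" "bij_betw f D D" "P \<subseteq> D"
    and "\<And>j. j \<in> D \<Longrightarrow> {j, f j} \<inter> (P \<union> f ` P) \<noteq> {}"
  shows "card D \<le> 3 * card P"
proof -
  have inj: "inj_on f D" using assms(2) by (simp add: bij_betw_def)
  have fin: "finite P" using assms(1,3) finite_subset by blast
  let ?Q = "{j \<in> D. f j \<in> P}"
  have "D \<subseteq> P \<union> f ` P \<union> ?Q"
  proof
    fix j assume j: "j \<in> D"
    \<comment> \<open>The fourth way to be blocked, \<open>f j\<close> in the image of
      \<open>P\<close>, reduces to \<open>j \<in> P\<close> by injectivity.\<close>
    have "j \<in> P" if "f j \<in> f ` P"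
      using that inj_on_image_mem_iff[OF inj j assms(3)] by simp
    with assms(4)[OF j] j show "j \<in> P \<union> f ` P \<union> ?Q" by auto
  qed
  hence "card D \<le> card (P \<union> f ` P \<union> ?Q)"
    using fin assms(1) by (intro card_mono) auto
  also have "\<dots> \<le> card P + card (f ` P) + card ?Q"
    by (meson card_Un_le le_trans add_le_mono1)
  also have "card (f ` P) \<le> card P" by (rule card_image_le[OF fin])
  also have "card ?Q \<le> card P"
    by (rule card_inj_on_le[of f]) (use inj fin in \<open>auto intro: inj_on_subset\<close>)
  finally show ?thesis by simp
qed


section \<open>Cyclic shifts\<close>

text \<open>This is the partner index computed in \<open>ou_step\<close>. The integer offset makes
  the shifts a group, with \<open>- v\<close> inverse to \<open>v\<close> on
  \<open>{..<n}\<close>.\<close>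

definition cyc :: "nat \<Rightarrow> int \<Rightarrow> nat \<Rightarrow> nat" where
  "cyc n v j = nat ((int j + v) mod int n)"

lemma cyc_less: "0 < n \<Longrightarrow> cyc n v j < n"
  by (simp add: cyc_def nat_less_iff)

lemma cyc_cyc: "0 < n \<Longrightarrow> cyc n v (cyc n w j) = cyc n (v + w) j"
  by (simp add: cyc_def mod_add_right_eq algebra_simps)

lemma cyc_0: "j < n \<Longrightarrow> cyc n 0 j = j"
  by (simp add: cyc_def)

lemma cyc_of_nat: "cyc n (int k) j = (j + k) mod n"
  by (simp add: cyc_def flip: of_nat_add zmod_int)

lemma bij_betw_cyc:
  assumes "0 < n"
  shows "bij_betw (cyc n v) {..<n} {..<n}"
  by (rule bij_betw_byWitness[where f' = "cyc n (- v)"])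
     (use assms in \<open>auto simp: cyc_cyc cyc_0 cyc_less\<close>)

lemma cyc_neq:
  assumes "0 < \<bar>v\<bar>" "\<bar>v\<bar> < int n"
  shows "cyc n v j \<noteq> j"
proof
  assume "cyc n v j = j"
  hence "(int j + v) mod int n = int j mod int n"
    using assms by (metis cyc_def int_nat_eq mod_mod_trivial pos_mod_sign abs_ge_zero le_less_trans)
  hence "int n dvd v" by (simp add: mod_eq_dvd_iff)
  with assms show False using zdvd_imp_le[of "int n" "\<bar>v\<bar>"] by simp
qed

lemma cyc_commute: "0 < n \<Longrightarrow> cyc n v (cyc n w j) = cyc n w (cyc n v j)"
  by (simp add: cyc_cyc add.commute)

section \<open>Dirichlet energy of a cyclic shift\<close>

text \<open>One term per directed edge of the circulant graph with step \<open>v\<close>. For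
  \<open>v\<close> equal to half of \<open>n\<close> every undirected edge counts twice, so no
  separate case arises.\<close>

definition dirichlet :: "nat \<Rightarrow> int \<Rightarrow> (nat \<Rightarrow> real) \<Rightarrow> real" where
  "dirichlet n v z = (\<Sum>j<n. (z j - z (cyc n v j))\<^sup>2)"

lemma sum_cyc: "0 < n \<Longrightarrow> (\<Sum>j<n. h (cyc n v j)) = (\<Sum>j<n. h j)"
  by (rule sum.reindex_bij_betw[OF bij_betw_cyc])

text \<open>Reindexing by the shift exchanges the ends of each edge. Hence the two signs of an
  offset contribute equally.\<close>

lemma dirichlet_uminus:
  assumes "0 < n"
  shows "dirichlet n (- v) z = dirichlet n v z"
proof -
  have "dirichlet n (- v) z = (\<Sum>j<n. (z (cyc n v j) - z (cyc n (- v) (cyc n v j)))\<^sup>2)"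
    unfolding dirichlet_def using sum_cyc[OF assms, of "\<lambda>j. (z j - z (cyc n (- v) j))\<^sup>2" v] by simp
  also have "\<dots> = dirichlet n v z"
    unfolding dirichlet_def
    by (intro sum.cong) (auto simp: cyc_cyc[OF assms] cyc_0 power2_commute)
  finally show ?thesis .
qed

lemma dirichlet_nonneg: "0 \<le> dirichlet n v z"
  by (simp add: dirichlet_def sum_nonneg)

text \<open>After expanding the square, both sums of squares agree by invariance under the shift.
  This turns the correlations in the quadratic form of the static matrix into energies.\<close>

lemma dirichlet_correlation:
  assumes "0 < n"
  shows "(\<Sum>j<n. z (cyc n v j) * z j) = (\<Sum>j<n. (z j)\<^sup>2) - dirichlet n v z / 2"
proof -
  have "dirichlet n v z =
      (\<Sum>j<n. (z j)\<^sup>2) + (\<Sum>j<n. (z (cyc n v j))\<^sup>2) - 2 * (\<Sum>j<n. z (cyc n v j) * z j)"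
    unfolding dirichlet_def sum_distrib_left sum.distrib[symmetric] sum_subtractf[symmetric]
    by (intro sum.cong) (auto simp: power2_eq_square algebra_simps)
  thus ?thesis using sum_cyc[OF assms, of "\<lambda>j. (z j)\<^sup>2" v] by (simp add: field_simps)
qed


section \<open>Greedy pairing along a cyclic shift\<close>

definition proposers :: "nat \<Rightarrow> int \<Rightarrow> nat \<Rightarrow> nat set" where
  "proposers n v s = fold (greedy_step (cyc n v)) (map (\<lambda>k. (s + k) mod n) [0..<n]) {}"

lemma proposers_subset: "0 < n \<Longrightarrow> proposers n v s \<subseteq> {..<n}"
  unfolding proposers_def by (rule fold_greedy_subset) auto

lemma proposers_matching:
  assumes "0 < \<bar>v\<bar>" "\<bar>v\<bar> < int n"
  shows "inj_on (cyc n v) (proposers n v s)" "proposers n v s \<inter> cyc n v ` proposers n v s = {}"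
  using fold_greedy_matching[of "map (\<lambda>k. (s + k) mod n) [0..<n]" "cyc n v" "{}"]
    cyc_neq[OF assms] unfolding proposers_def by auto

text \<open>Both the scan order and the partner map are compatible with rotation, as shifts
  commute.\<close>

lemma proposers_rotate:
  assumes "0 < n"
  shows "proposers n v s = cyc n (int s) ` proposers n v 0"
proof -
  have 0: "map (\<lambda>k. (0 + k) mod n) [0..<n] = [0..<n]"
    by (rule map_idI) auto
  have s: "map (\<lambda>k. (s + k) mod n) [0..<n] = map (cyc n (int s)) [0..<n]"
    by (simp add: cyc_of_nat add.commute)
  have "fold (greedy_step (cyc n v)) (map (cyc n (int s)) [0..<n]) (cyc n (int s) ` {}) =
      cyc n (int s) ` fold (greedy_step (cyc n v)) [0..<n] {}"
    by (rule fold_greedy_equivariant[where D = "{..<n}"])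
       (use bij_betw_cyc[OF assms, of "int s"] cyc_less[OF assms] cyc_commute[OF assms]
         in \<open>auto simp: bij_betw_def\<close>)
  thus ?thesis unfolding proposers_def s 0 by simp
qed

text \<open>Rotating \<open>p\<close> by \<open>s\<close> is the same as rotating \<open>s\<close>
  by \<open>p\<close>. For fixed \<open>p\<close> the start \<open>s\<close> therefore sweeps all
  nodes once, and each proposer contributes the full sum.\<close>

lemma sum_proposers:
  fixes h :: "nat \<Rightarrow> real"
  assumes "0 < n"
  shows "(\<Sum>s<n. \<Sum>p\<in>proposers n v s. h p) = card (proposers n v 0) * (\<Sum>j<n. h j)"
proof -
  have "(\<Sum>p\<in>proposers n v s. h p) = (\<Sum>p\<in>proposers n v 0. h (cyc n (int p) s))"
    if "s < n" for s
  proof -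
    have "inj_on (cyc n (int s)) (proposers n v 0)"
      using bij_betw_cyc[OF assms, of "int s"] proposers_subset[OF assms]
      by (auto simp: bij_betw_def intro: inj_on_subset)
    hence "(\<Sum>p\<in>proposers n v s. h p) = (\<Sum>p\<in>proposers n v 0. h (cyc n (int s) p))"
      unfolding proposers_rotate[OF assms, of v s] by (simp add: sum.reindex)
    thus ?thesis by (simp add: cyc_of_nat add.commute)
  qed
  hence "(\<Sum>s<n. \<Sum>p\<in>proposers n v s. h p) =
      (\<Sum>s<n. \<Sum>p\<in>proposers n v 0. h (cyc n (int p) s))" by simp
  also have "\<dots> = (\<Sum>p\<in>proposers n v 0. \<Sum>s<n. h (cyc n (int p) s))" by (rule sum.swap)
  finally show ?thesis by (simp add: sum_cyc[OF assms])
qed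

lemma card_proposers: "0 < n \<Longrightarrow> n \<le> 3 * card (proposers n v 0)"
  using card_maximal_matching[of "{..<n}" "cyc n v" "proposers n v 0"] bij_betw_cyc[of n v]
    proposers_subset[of n v 0]
    fold_greedy_maximal[of _ "map (\<lambda>k. (0 + k) mod n) [0..<n]" "cyc n v" "{}"]
  unfolding proposers_def by auto

section \<open>The matrix of a pairing and its effect on the squared norm\<close>

text \<open>Closed form of the matrix built by the loop when the pairs are \<open>p\<close>,
  \<open>f p\<close> with \<open>p \<in> P\<close>. The diagonal is tested first, mirroring the loop
  body, where it is written last.\<close>

definition pairing_entry :: "nat \<Rightarrow> (nat \<Rightarrow> nat) \<Rightarrow> nat set \<Rightarrow> nat \<times> nat \<Rightarrow> real" where
  "pairing_entry n f P = (\<lambda>(k, l).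
     if l = k then (if k \<in> P \<union> f ` P then 1 / n else 1)
     else if k \<in> P \<and> l = f k \<or> l \<in> P \<and> k = f l then (real n - 1) / n else 0)"

lemma pairing_entry_insert:
  assumes "j \<notin> P \<union> f ` P" "f j \<notin> P \<union> f ` P"
  shows "(pairing_entry n f P)((f j, j) := (real n - 1) / n, (j, f j) := (real n - 1) / n,
      (f j, f j) := 1 / n, (j, j) := 1 / n) = pairing_entry n f (insert j P)"
proof
  fix x :: "nat \<times> nat"
  obtain k l where x: "x = (k, l)" by (cases x)
  show "((pairing_entry n f P)((f j, j) := (real n - 1) / n, (j, f j) := (real n - 1) / n,
      (f j, f j) := 1 / n, (j, j) := 1 / n)) x = pairing_entry n f (insert j P) x"
    unfolding x using assms
    by (cases "k = j"; cases "l = j"; cases "k = f j"; cases "l = f j")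
       (simp_all add: pairing_entry_def)
qed

text \<open>Loop invariant: a state is determined by its set of proposers, with flags raised exactly
  on the endpoints, so the loop on matrices follows \<open>greedy_step\<close> on sets.\<close>

lemma ou_step_pairing_entry:
  "ou_step n v j (pairing_entry n (cyc n v) P, \<lambda>k. k \<in> P \<union> cyc n v ` P) =
   (pairing_entry n (cyc n v) (greedy_step (cyc n v) j P),
    \<lambda>k. k \<in> greedy_step (cyc n v) j P \<union> cyc n v ` greedy_step (cyc n v) j P)"
proof (cases "{j, cyc n v j} \<inter> (P \<union> cyc n v ` P) = {}")
  case True
  hence free: "j \<notin> P \<union> cyc n v ` P" "cyc n v j \<notin> P \<union> cyc n v ` P" by blast+
  have "(\<lambda>k. k \<in> P \<union> cyc n v ` P)(cyc n v j := True, j := True) =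
      (\<lambda>k. k \<in> insert j P \<union> cyc n v ` insert j P)"
    by (rule ext) simp
  thus ?thesis
    unfolding ou_step_def greedy_step_def cyc_def[symmetric] Let_def prod.case if_P[OF True]
      if_P[OF conjI[OF free(2,1)]] pairing_entry_insert[OF free]
    by simp
next
  case False
  hence "\<not> (cyc n v j \<notin> P \<union> cyc n v ` P \<and> j \<notin> P \<union> cyc n v ` P)" by blast
  thus ?thesis
    unfolding ou_step_def greedy_step_def cyc_def[symmetric] Let_def prod.case if_not_P[OF False]
    by (rule if_not_P)
qed

lemma ou_mat_eq: "ou_mat n v s = mat n n (pairing_entry n (cyc n v) (proposers n v s))"
proof -
  have fold: "fold (ou_step n v) js (pairing_entry n (cyc n v) P, \<lambda>k. k \<in> P \<union> cyc n v ` P) =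
     (pairing_entry n (cyc n v) (fold (greedy_step (cyc n v)) js P),
      \<lambda>k. k \<in> fold (greedy_step (cyc n v)) js P \<union> cyc n v ` fold (greedy_step (cyc n v)) js P)"
    for js P
    by (induction js arbitrary: P) (simp_all only: fold_simps ou_step_pairing_entry)
  \<comment> \<open>The initial state, the identity with no flag raised, is the invariant for the
    empty set.\<close>
  have "(\<lambda>(i, j). if i = j then 1 else 0) = pairing_entry n (cyc n v) {}"
    by (auto simp: pairing_entry_def fun_eq_iff)
  thus ?thesis
    using fold[of "map (\<lambda>k. (s + k) mod n) [0..<n]" "{}"]
    unfolding ou_mat_def proposers_def by simp
qed

text \<open>Disjointness of the pairs leaves at most two nonzero entries in each row.\<close>

lemma pairing_entry_sum:
  assumes "P \<subseteq> {..<n}" "f ` P \<subseteq> {..<n}" "inj_on f P" "P \<inter> f ` P = {}" "0 < n"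
  shows "p \<in> P \<Longrightarrow> (\<Sum>l<n. pairing_entry n f P (p, l) * z l) = z p / n + (real n - 1) / n * z (f p)"
    and "p \<in> P \<Longrightarrow> (\<Sum>l<n. pairing_entry n f P (f p, l) * z l) = z (f p) / n + (real n - 1) / n * z p"
    and "k < n \<Longrightarrow> k \<notin> P \<union> f ` P \<Longrightarrow> (\<Sum>l<n. pairing_entry n f P (k, l) * z l) = z k"
proof -
  have two: "(\<Sum>l<n. (if l = i then a else if l = j then b else 0) * z l) = a * z i + b * z j"
    if "i < n" "j < n" "i \<noteq> j" for i j and a b :: real
  proof -
    have "(\<Sum>l<n. (if l = i then a else if l = j then b else 0) * z l) =
        (\<Sum>l<n. (if l = i then a * z l else 0) + (if l = j then b * z l else 0))"
      using that by (intro sum.cong) auto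
    thus ?thesis using that by (simp add: sum.distrib)
  qed
  {
    assume p: "p \<in> P"
    have fp: "f p < n" "p < n" "f p \<noteq> p" using p assms(1,2,4) by (auto, metis disjoint_iff imageI)
    have "pairing_entry n f P (p, l) = (if l = p then 1 / n else if l = f p then (real n - 1) / n else 0)"
      "pairing_entry n f P (f p, l) = (if l = f p then 1 / n else if l = p then (real n - 1) / n else 0)"
      for l using p assms(3,4) fp(3) by (auto simp: pairing_entry_def dest: inj_onD)
    thus "(\<Sum>l<n. pairing_entry n f P (p, l) * z l) = z p / n + (real n - 1) / n * z (f p)"
      "(\<Sum>l<n. pairing_entry n f P (f p, l) * z l) = z (f p) / n + (real n - 1) / n * z p"
      using fp two[of p "f p"] two[of "f p" p] by auto
  }
  {
    assume k: "k < n" "k \<notin> P \<union> f ` P"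
    hence "pairing_entry n f P (k, l) = (if l = k then 1 else 0)" for l
      by (auto simp: pairing_entry_def)
    thus "(\<Sum>l<n. pairing_entry n f P (k, l) * z l) = z k"
      using k by (simp add: if_distrib[of "\<lambda>a. a * _"] cong: if_cong)
  }
qed

text \<open>A pair keeps its sum while its difference is multiplied by \<open>1 - 2 * c\<close>; the
  sum of its two squares thus drops by \<open>2 * c * (1 - c)\<close> times the squared
  difference.\<close>

lemma lazy_pairing_norm:
  fixes z :: "nat \<Rightarrow> real" and \<eta> :: real
  assumes "P \<subseteq> {..<n}" "f ` P \<subseteq> {..<n}" "inj_on f P" "P \<inter> f ` P = {}" "0 < n"
  defines "c \<equiv> \<eta> * (real n - 1) / n"
  shows "(\<Sum>k<n. ((1 - \<eta>) * z k + \<eta> * (\<Sum>l<n. pairing_entry n f P (k, l) * z l))\<^sup>2) =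
    (\<Sum>k<n. (z k)\<^sup>2) - 2 * c * (1 - c) * (\<Sum>p\<in>P. (z p - z (f p))\<^sup>2)"
proof -
  define w where "w k = (1 - \<eta>) * z k + \<eta> * (\<Sum>l<n. pairing_entry n f P (k, l) * z l)" for k
  have fin: "finite P" using assms(1) finite_subset by blast
  have w1: "w p = z p - c * (z p - z (f p))" if "p \<in> P" for p
    unfolding w_def c_def pairing_entry_sum(1)[OF assms(1-5) that, of z] using assms(5)
    by (simp add: field_simps)
  have w2: "w (f p) = z (f p) + c * (z p - z (f p))" if "p \<in> P" for p
    unfolding w_def c_def pairing_entry_sum(2)[OF assms(1-5) that, of z] using assms(5)
    by (simp add: field_simps)
  have w3: "w k = z k" if "k < n" "k \<notin> P \<union> f ` P" for k
    using pairing_entry_sum(3)[OF assms(1-5) that, of z] by (simp add: w_def algebra_simps)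
  have "(\<Sum>k<n. (w k)\<^sup>2) - (\<Sum>k<n. (z k)\<^sup>2) = (\<Sum>k<n. (w k)\<^sup>2 - (z k)\<^sup>2)"
    by (simp add: sum_subtractf)
  also have "\<dots> = (\<Sum>k\<in>P \<union> f ` P. (w k)\<^sup>2 - (z k)\<^sup>2)"
    using assms(1,2) w3 by (intro sum.mono_neutral_right) auto
  also have "\<dots> = (\<Sum>k\<in>P. (w k)\<^sup>2 - (z k)\<^sup>2) + (\<Sum>k\<in>f ` P. (w k)\<^sup>2 - (z k)\<^sup>2)"
    using fin assms(4) by (intro sum.union_disjoint) auto
  also have "\<dots> = (\<Sum>p\<in>P. (w p)\<^sup>2 - (z p)\<^sup>2 + ((w (f p))\<^sup>2 - (z (f p))\<^sup>2))"
    by (simp add: sum.reindex[OF assms(3)] sum.distrib)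
  also have "\<dots> = (\<Sum>p\<in>P. - (2 * c * (1 - c)) * (z p - z (f p))\<^sup>2)"
    by (intro sum.cong refl) (simp add: w1 w2 power2_eq_square algebra_simps)
  also have "\<dots> = - (2 * c * (1 - c)) * (\<Sum>p\<in>P. (z p - z (f p))\<^sup>2)"
    by (rule sum_distrib_left[symmetric])
  finally show ?thesis unfolding w_def by simp
qed


section \<open>Centering and the consensus rate\<close>

lemma euclid_norm_sq: "(euclid_norm x)\<^sup>2 = (\<Sum>i<dim_vec x. (vec_index x i)\<^sup>2)"
  by (simp add: euclid_norm_def sum_nonneg)

lemma euclid_norm_nonneg: "0 \<le> euclid_norm x"
  by (simp add: euclid_norm_def sum_nonneg)

lemma mult_mat_vec_index:
  assumes "A \<in> carrier_mat n m" "x \<in> carrier_vec m" "i < n"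
  shows "vec_index (A *\<^sub>v x) i = (\<Sum>j<m. A $$ (i, j) * vec_index x j)"
  using assms by (auto simp: scalar_prod_def lessThan_atLeast0 intro!: sum.cong)

lemma Pi_mat_carrier [simp]: "Pi_mat n \<in> carrier_mat n n"
  by (simp add: Pi_mat_def avg_mat_def minus_carrier_mat)

lemma Pi_mat_index:
  assumes "x \<in> carrier_vec n" "i < n"
  shows "vec_index (Pi_mat n *\<^sub>v x) i = vec_index x i - (\<Sum>j<n. vec_index x j) / n"
proof -
  have "vec_index (Pi_mat n *\<^sub>v x) i =
      (\<Sum>j<n. (if j = i then vec_index x j else 0) - vec_index x j / n)"
    unfolding mult_mat_vec_index[OF Pi_mat_carrier assms]
    using assms by (intro sum.cong) (auto simp: Pi_mat_def avg_mat_def algebra_simps)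
  thus ?thesis using assms by (simp add: sum_subtractf sum_divide_distrib)
qed

lemma Pi_mat_sum:
  assumes "x \<in> carrier_vec n" "0 < n"
  shows "(\<Sum>i<n. vec_index (Pi_mat n *\<^sub>v x) i) = 0"
  using assms by (simp add: Pi_mat_index sum_subtractf)

lemma Pi_mat_sum_zero:
  assumes "x \<in> carrier_vec n" "(\<Sum>i<n. vec_index x i) = 0"
  shows "Pi_mat n *\<^sub>v x = x"
  using assms carrier_matD[OF Pi_mat_carrier[of n]] by (intro eq_vecI)
    (auto simp: Pi_mat_index simp del: index_mult_mat_vec)

text \<open>Pythagoras: subtracting the mean lowers the squared norm by the square of the entry sum
  divided by \<open>n\<close>.\<close>

lemma euclid_norm_Pi_le:
  assumes "z \<in> carrier_vec n" "0 < n"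
  shows "euclid_norm (Pi_mat n *\<^sub>v z) \<le> euclid_norm z"
proof -
  define a b where "a = (\<Sum>j<n. vec_index z j)" and "b = a / n"
  have "(euclid_norm (Pi_mat n *\<^sub>v z))\<^sup>2 = (\<Sum>i<n. (vec_index z i - b)\<^sup>2)"
    using assms carrier_matD[OF Pi_mat_carrier[of n]]
    by (simp add: euclid_norm_sq Pi_mat_index a_def b_def del: index_mult_mat_vec)
  also have "\<dots> = (\<Sum>i<n. (vec_index z i)\<^sup>2 + (b\<^sup>2 - 2 * b * vec_index z i))"
    by (intro sum.cong) (auto simp: power2_eq_square algebra_simps)
  also have "\<dots> = (\<Sum>i<n. (vec_index z i)\<^sup>2) + (n * b\<^sup>2 - 2 * b * a)"
    by (simp add: sum.distrib sum_subtractf sum_distrib_left a_def)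
  also have "\<dots> = (euclid_norm z)\<^sup>2 - a\<^sup>2 / n"
  proof -
    have "n * b\<^sup>2 - 2 * b * a = - (a\<^sup>2 / n)"
      using assms(2) by (simp add: b_def power2_eq_square field_simps)
    thus ?thesis using assms(1) by (simp add: euclid_norm_sq)
  qed
  also have "\<dots> \<le> (euclid_norm z)\<^sup>2" by simp
  finally show ?thesis using euclid_norm_nonneg power2_le_imp_le by blast
qed

text \<open>Row sums 1 make \<open>W\<close> fix constant vectors, so centring \<open>x\<close>
  first changes \<open>W *\<^sub>v x\<close> only by a constant, which \<open>Pi_mat\<close>
  removes; projecting afterwards cannot increase the norm.\<close>

lemma Pi_mat_stochastic:
  assumes "W \<in> carrier_mat n n" "\<And>i. i < n \<Longrightarrow> (\<Sum>j<n. W $$ (i, j)) = 1"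
    and "x \<in> carrier_vec n" "0 < n"
  shows "euclid_norm (Pi_mat n *\<^sub>v (W *\<^sub>v x)) \<le> euclid_norm (W *\<^sub>v (Pi_mat n *\<^sub>v x))"
proof -
  define a where "a = (\<Sum>j<n. vec_index x j) / n"
  have carr: "Pi_mat n *\<^sub>v x \<in> carrier_vec n" "W *\<^sub>v x \<in> carrier_vec n"
    using assms by (auto intro!: mult_mat_vec_carrier)
  have carr': "W *\<^sub>v (Pi_mat n *\<^sub>v x) \<in> carrier_vec n"
    using assms carr by (auto intro!: mult_mat_vec_carrier)
  have idx: "vec_index (W *\<^sub>v (Pi_mat n *\<^sub>v x)) i = vec_index (W *\<^sub>v x) i - a" if "i < n" for i
  proof -
    have "vec_index (W *\<^sub>v (Pi_mat n *\<^sub>v x)) i =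
        (\<Sum>j<n. W $$ (i, j) * vec_index x j - W $$ (i, j) * a)"
      unfolding mult_mat_vec_index[OF assms(1) carr(1) that]
      by (intro sum.cong) (auto simp: Pi_mat_index[OF assms(3)] a_def algebra_simps)
    thus ?thesis
      using assms(2)[OF that]
      by (simp add: sum_subtractf sum_distrib_right[symmetric] mult_mat_vec_index[OF assms(1,3) that])
  qed
  hence sum: "(\<Sum>i<n. vec_index (W *\<^sub>v (Pi_mat n *\<^sub>v x)) i) =
      (\<Sum>i<n. vec_index (W *\<^sub>v x) i) - n * a"
    by (simp add: sum_subtractf del: index_mult_mat_vec)
  have "Pi_mat n *\<^sub>v (W *\<^sub>v x) = Pi_mat n *\<^sub>v (W *\<^sub>v (Pi_mat n *\<^sub>v x))"
  proof (rule eq_vecI)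
    fix i assume "i < dim_vec (Pi_mat n *\<^sub>v (W *\<^sub>v (Pi_mat n *\<^sub>v x)))"
    hence "i < n" using carrier_matD[OF Pi_mat_carrier[of n]] by simp
    thus "vec_index (Pi_mat n *\<^sub>v (W *\<^sub>v x)) i =
        vec_index (Pi_mat n *\<^sub>v (W *\<^sub>v (Pi_mat n *\<^sub>v x))) i"
      unfolding Pi_mat_index[OF carr(2) \<open>i < n\<close>] Pi_mat_index[OF carr' \<open>i < n\<close>]
      unfolding sum idx[OF \<open>i < n\<close>] using assms(4) by (simp add: diff_divide_distrib)
  qed simp
  thus ?thesis using euclid_norm_Pi_le[OF carr' assms(4)] by simp
qed

text \<open>Bound by the Frobenius norm, from Cauchy-Schwarz in each row. It only has to supply some
  admissible rate.\<close>

lemma euclid_norm_mult_le: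
  assumes "W \<in> carrier_mat n n" "y \<in> carrier_vec n"
  shows "euclid_norm (W *\<^sub>v y) \<le> sqrt (\<Sum>i<n. \<Sum>j<n. (W $$ (i, j))\<^sup>2) * euclid_norm y"
proof -
  have "(\<Sum>i<n. (vec_index (W *\<^sub>v y) i)\<^sup>2) \<le>
      (\<Sum>i<n. (\<Sum>j<n. (W $$ (i, j))\<^sup>2) * (\<Sum>j<n. (vec_index y j)\<^sup>2))"
    by (intro sum_mono) (simp add: mult_mat_vec_index[OF assms] Cauchy_Schwarz_ineq_sum del: index_mult_mat_vec)
  thus ?thesis
    using assms
    by (simp add: euclid_norm_def sum_distrib_right real_sqrt_mult[symmetric] del: index_mult_mat_vec)
qed

text \<open>The minimum defining the consensus rate is attained, so \<open>LEAST\<close> is not a junk value.\<close>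

lemma consensus_rate_bound:
  assumes "W \<in> carrier_mat n n" "\<And>i. i < n \<Longrightarrow> (\<Sum>j<n. W $$ (i, j)) = 1"
    and "x \<in> carrier_vec n" "0 < n"
  shows "euclid_norm (Pi_mat n *\<^sub>v (W *\<^sub>v x)) \<le> consensus_rate n W * euclid_norm (Pi_mat n *\<^sub>v x)"
proof -
  define R where "R = {\<rho>. 0 \<le> \<rho> \<and> (\<forall>x\<in>carrier_vec n.
     euclid_norm (Pi_mat n *\<^sub>v (W *\<^sub>v x)) \<le> \<rho> * euclid_norm (Pi_mat n *\<^sub>v x))}"
  have "sqrt (\<Sum>i<n. \<Sum>j<n. (W $$ (i, j))\<^sup>2) \<in> R"
  proof -
    have "euclid_norm (Pi_mat n *\<^sub>v (W *\<^sub>v x)) \<le>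
        sqrt (\<Sum>i<n. \<Sum>j<n. (W $$ (i, j))\<^sup>2) * euclid_norm (Pi_mat n *\<^sub>v x)"
      if "x \<in> carrier_vec n" for x
      using Pi_mat_stochastic[OF assms(1,2) that assms(4)]
        euclid_norm_mult_le[OF assms(1) mult_mat_vec_carrier[OF Pi_mat_carrier that]] by simp
    thus ?thesis by (simp add: R_def sum_nonneg)
  qed
  hence ne: "R \<noteq> {}" by auto
  have bdd: "bdd_below R" unfolding R_def by (rule bdd_belowI[of _ 0]) auto
  \<comment> \<open>Each \<open>x\<close> imposes a closed condition on the rate, so the infimum
    satisfies all of them.\<close>
  have "closed R"
  proof -
    have "R = {0..} \<inter> (\<Inter>x\<in>carrier_vec n.
        {\<rho>. euclid_norm (Pi_mat n *\<^sub>v (W *\<^sub>v x)) \<le> \<rho> * euclid_norm (Pi_mat n *\<^sub>v x)})"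
      by (auto simp: R_def)
    also have "closed \<dots>"
      by (intro closed_Int closed_INT ballI closed_Collect_le closed_atLeast continuous_intros)
    finally show ?thesis .
  qed
  hence Inf: "Inf R \<in> R" by (rule closed_contains_Inf[OF ne bdd])
  have "consensus_rate n W = Inf R"
    unfolding consensus_rate_def
    by (rule Least_equality) (use Inf cInf_lower[OF _ bdd] in \<open>auto simp: R_def\<close>)
  with Inf assms(3) show ?thesis by (simp add: R_def)
qed


section \<open>The static matrix\<close>

lemma u_equi_static_carrier [simp]: "u_equi_static n M u \<in> carrier_mat n n"
  by (simp add: u_equi_static_def)

lemma u_equi_static_index:
  assumes "i < n" "j < n"
  shows "u_equi_static n M u $$ (i, j) =
    (\<Sum>m\<in>{1..M}. basis_mat n (u m) $$ (i, j) + basis_mat n (u m) $$ (j, i)) / (2 * M)"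
  using assms by (simp add: u_equi_static_def basis_mat_def)

text \<open>The two branches exclude each other because the offset is nonzero modulo
  \<open>n\<close>, so the nested conditional becomes a sum.\<close>

lemma basis_mat_index:
  assumes "i < n" "j < n" "k \<in> {1..n - 1}"
  shows "basis_mat n k $$ (i, j) =
    (if i = cyc n (int k) j then (real n - 1) / n else 0) + (if i = j then 1 / n else 0)"
proof -
  have "0 < k" "k < n" using assms(3) by auto
  hence "(j + k) mod n \<noteq> j" using cyc_neq[of "int k" n j] unfolding cyc_of_nat by simp
  thus ?thesis using assms by (auto simp: basis_mat_def cyc_of_nat)
qed

lemma basis_mat_bilinear:
  assumes "k \<in> {1..n - 1}"
  shows "(\<Sum>i<n. \<Sum>j<n. basis_mat n k $$ (i, j) * (x i * y j)) =
    (real n - 1) / n * (\<Sum>j<n. x (cyc n k j) * y j) + (\<Sum>j<n. x j * y j) / n"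
proof -
  have n: "0 < n" using assms by auto
  have "(\<Sum>i<n. basis_mat n k $$ (i, j) * (x i * y j)) =
      (real n - 1) / n * (x (cyc n k j) * y j) + x j * y j / n" if "j < n" for j
  proof -
    have "(\<Sum>i<n. basis_mat n k $$ (i, j) * (x i * y j)) =
        (\<Sum>i<n. (if i = cyc n k j then (real n - 1) / n * (x i * y j) else 0) +
          (if i = j then x i * y j / n else 0))"
      using that assms by (intro sum.cong) (auto simp: basis_mat_index algebra_simps add_divide_distrib)
    thus ?thesis using that cyc_less[OF n, of k j] by (simp add: sum.distrib)
  qed
  thus ?thesis
    by (subst sum.swap) (simp add: sum.distrib sum_distrib_left sum_divide_distrib)
qed

text \<open>Two vectors are kept for two uses: a unit vector against the constant 1 gives row sums,
  and equal vectors give the quadratic form. Transposition exchanges \<open>x\<close> and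
  \<open>y\<close>.\<close>

lemma u_equi_static_bilinear:
  assumes "\<forall>m\<in>{1..M}. u m \<in> {1..n - 1}"
  shows "(\<Sum>i<n. \<Sum>j<n. u_equi_static n M u $$ (i, j) * (x i * y j)) =
    (\<Sum>m\<in>{1..M}. (real n - 1) / n *
        (\<Sum>j<n. x (cyc n (u m) j) * y j + y (cyc n (u m) j) * x j)
      + 2 * (\<Sum>j<n. x j * y j) / n) / (2 * M)"
proof -
  have "(\<Sum>i<n. \<Sum>j<n. u_equi_static n M u $$ (i, j) * (x i * y j)) =
      (\<Sum>i<n. \<Sum>j<n. \<Sum>m\<in>{1..M}. (basis_mat n (u m) $$ (i, j) * (x i * y j)
        + basis_mat n (u m) $$ (j, i) * (y j * x i)) / (2 * M))"
    by (intro sum.cong refl)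
       (simp add: u_equi_static_index sum_divide_distrib sum_distrib_left sum_distrib_right
         add_divide_distrib algebra_simps)
  also have "\<dots> = (\<Sum>m\<in>{1..M}. \<Sum>i<n. \<Sum>j<n. (basis_mat n (u m) $$ (i, j) * (x i * y j)
        + basis_mat n (u m) $$ (j, i) * (y j * x i)) / (2 * M))"
    by (simp only: sum.swap[of _ "{1..M}" "{..<n}"])
  also have "\<dots> = (\<Sum>m\<in>{1..M}. ((\<Sum>i<n. \<Sum>j<n. basis_mat n (u m) $$ (i, j) * (x i * y j))
        + (\<Sum>j<n. \<Sum>i<n. basis_mat n (u m) $$ (j, i) * (y j * x i))) / (2 * M))"
  proof (intro sum.cong refl)
    fix m
    have "(\<Sum>j<n. \<Sum>i<n. basis_mat n (u m) $$ (j, i) * (y j * x i)) =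
        (\<Sum>i<n. \<Sum>j<n. basis_mat n (u m) $$ (j, i) * (y j * x i))" by (rule sum.swap)
    thus "(\<Sum>i<n. \<Sum>j<n. (basis_mat n (u m) $$ (i, j) * (x i * y j)
        + basis_mat n (u m) $$ (j, i) * (y j * x i)) / (2 * M)) =
      ((\<Sum>i<n. \<Sum>j<n. basis_mat n (u m) $$ (i, j) * (x i * y j))
        + (\<Sum>j<n. \<Sum>i<n. basis_mat n (u m) $$ (j, i) * (y j * x i))) / (2 * M)"
      by (simp only: sum.distrib sum_divide_distrib[symmetric])
  qed
  also have "\<dots> = (\<Sum>m\<in>{1..M}. ((real n - 1) / n *
        (\<Sum>j<n. x (cyc n (u m) j) * y j + y (cyc n (u m) j) * x j)
      + 2 * (\<Sum>j<n. x j * y j) / n) / (2 * M))"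
  proof (intro sum.cong refl arg_cong2[where f = "(/)"])
    fix m assume "m \<in> {1..M}"
    hence m: "u m \<in> {1..n - 1}" using assms by blast
    have comm: "(\<Sum>j<n. y j * x j) = (\<Sum>j<n. x j * y j)" by (simp add: mult.commute)
    show "(\<Sum>i<n. \<Sum>j<n. basis_mat n (u m) $$ (i, j) * (x i * y j))
        + (\<Sum>j<n. \<Sum>i<n. basis_mat n (u m) $$ (j, i) * (y j * x i)) =
      (real n - 1) / n * (\<Sum>j<n. x (cyc n (u m) j) * y j + y (cyc n (u m) j) * x j)
        + 2 * (\<Sum>j<n. x j * y j) / n"
      unfolding basis_mat_bilinear[OF m] sum.distrib comm by (simp add: distrib_left)
  qed
  finally show ?thesis by (simp add: sum_divide_distrib)
qed

lemma u_equi_static_row_sum: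
  assumes "\<forall>m\<in>{1..M}. u m \<in> {1..n - 1}" "1 \<le> M" "i < n"
  shows "(\<Sum>j<n. u_equi_static n M u $$ (i, j)) = 1"
proof -
  \<comment> \<open>The unit vector at \<open>i\<close>, which extracts row \<open>i\<close> from
    the bilinear form.\<close>
  define e where "e k = (if k = i then 1 else 0 :: real)" for k
  have e: "(\<Sum>j<n. e j) = 1" using assms(3) by (simp add: e_def)
  have "(\<Sum>j<n. u_equi_static n M u $$ (i, j)) =
      (\<Sum>k<n. \<Sum>j<n. u_equi_static n M u $$ (k, j) * (e k * 1))"
  proof -
    have "(\<Sum>k<n. \<Sum>j<n. u_equi_static n M u $$ (k, j) * (e k * 1)) =
        (\<Sum>k<n. if k = i then \<Sum>j<n. u_equi_static n M u $$ (i, j) else 0)"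
      by (intro sum.cong) (auto simp: e_def)
    thus ?thesis using assms(3) by simp
  qed
  also have "\<dots> = (\<Sum>m\<in>{1..M}. (real n - 1) / n * 2 + 2 / n) / (2 * M)"
    unfolding u_equi_static_bilinear[OF assms(1), of e "\<lambda>_. 1"]
    using sum_cyc[of n e] assms(3) e by (simp add: sum.distrib)
  also have "(real n - 1) / n * 2 + 2 / n = 2"
    using assms(3) by (simp add: field_simps)
  finally show ?thesis using assms(2) by simp
qed

text \<open>The quadratic form of the static matrix at \<open>y\<close> is at most the rate times
  the squared norm of \<open>y\<close>, and it equals this squared norm minus the right-hand
  side.\<close>

lemma dirichlet_ge_consensus:
  fixes u :: "nat \<Rightarrow> nat"
  assumes u: "\<forall>m\<in>{1..M}. u m \<in> {1..n - 1}" and "1 \<le> M" "2 \<le> n" and x: "x \<in> carrier_vec n"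
  defines "y \<equiv> Pi_mat n *\<^sub>v x"
  shows "(1 - consensus_rate n (u_equi_static n M u)) * (euclid_norm y)\<^sup>2
    \<le> (real n - 1) / (2 * n * M) * (\<Sum>m\<in>{1..M}. dirichlet n (u m) (vec_index y))"
proof -
  define W where "W = u_equi_static n M u"
  define N where "N = (\<Sum>i<n. (vec_index y i)\<^sup>2)"
  define S where "S = (\<Sum>m\<in>{1..M}. dirichlet n (u m) (vec_index y))"
  have n: "0 < n" using assms by simp
  have W: "W \<in> carrier_mat n n" by (simp add: W_def)
  have y: "y \<in> carrier_vec n" unfolding y_def by (rule mult_mat_vec_carrier[OF Pi_mat_carrier x])
  have z: "W *\<^sub>v y \<in> carrier_vec n" by (rule mult_mat_vec_carrier[OF W y])
  have y0: "(\<Sum>i<n. vec_index y i) = 0" unfolding y_def by (rule Pi_mat_sum[OF x n])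
  have N: "(euclid_norm y)\<^sup>2 = N" using y by (simp add: euclid_norm_sq N_def)
  let ?p = "Pi_mat n *\<^sub>v (W *\<^sub>v y)"
  have p: "?p \<in> carrier_vec n" by (rule mult_mat_vec_carrier[OF Pi_mat_carrier z])
  have "(\<Sum>i<n. \<Sum>j<n. W $$ (i, j) * (vec_index y i * vec_index y j)) =
      (\<Sum>i<n. vec_index y i * vec_index (W *\<^sub>v y) i)"
    by (intro sum.cong refl)
       (simp add: mult_mat_vec_index[OF W y] sum_distrib_left algebra_simps del: index_mult_mat_vec)
  \<comment> \<open>As \<open>y\<close> sums to zero, centring \<open>W *\<^sub>v y\<close> leaves
    the inner product alone; the rate controls only the centred vector.\<close>
  also have "\<dots> = (\<Sum>i<n. vec_index y i * vec_index ?p i)"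
  proof -
    define a where "a = (\<Sum>j<n. vec_index (W *\<^sub>v y) j) / n"
    have "(\<Sum>i<n. vec_index y i * vec_index ?p i) =
        (\<Sum>i<n. vec_index y i * vec_index (W *\<^sub>v y) i - vec_index y i * a)"
      by (intro sum.cong refl)
         (simp add: Pi_mat_index[OF z] a_def algebra_simps del: index_mult_mat_vec)
    thus ?thesis using y0 by (simp add: sum_subtractf sum_distrib_right[symmetric] del: index_mult_mat_vec)
  qed
  also have "\<dots> \<le> euclid_norm y * euclid_norm ?p"
  proof (rule power2_le_imp_le)
    show "(\<Sum>i<n. vec_index y i * vec_index ?p i)\<^sup>2 \<le> (euclid_norm y * euclid_norm ?p)\<^sup>2"
      using Cauchy_Schwarz_ineq_sum[of "vec_index y" "vec_index ?p" "{..<n}"] y p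
      by (simp only: euclid_norm_sq power_mult_distrib carrier_vecD)
    show "0 \<le> euclid_norm y * euclid_norm ?p" by (simp add: euclid_norm_nonneg)
  qed
  also have "\<dots> \<le> euclid_norm y * (consensus_rate n W * euclid_norm y)"
  proof -
    have "Pi_mat n *\<^sub>v y = y" by (rule Pi_mat_sum_zero[OF y y0])
    hence "euclid_norm ?p \<le> consensus_rate n W * euclid_norm y"
      using consensus_rate_bound[OF W u_equi_static_row_sum[OF u \<open>1 \<le> M\<close>, folded W_def] y n] by simp
    thus ?thesis by (rule mult_left_mono[OF _ euclid_norm_nonneg])
  qed
  also have "\<dots> = consensus_rate n W * N"
    by (simp add: N[symmetric] power2_eq_square)
  finally have le: "(\<Sum>i<n. \<Sum>j<n. W $$ (i, j) * (vec_index y i * vec_index y j)) \<le> consensus_rate n W * N" .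
  \<comment> \<open>Exact value: each \<open>m\<close> gives \<open>2 * (real n - 1) / n\<close>
    times a correlation plus \<open>2 * N / n\<close>, and the multiples of \<open>N\<close> add up
    to \<open>2 * N\<close>.\<close>
  have "(\<Sum>i<n. \<Sum>j<n. W $$ (i, j) * (vec_index y i * vec_index y j)) =
      (\<Sum>m\<in>{1..M}. 2 * N - (real n - 1) / n * dirichlet n (u m) (vec_index y)) / (2 * M)"
  proof -
    have "(\<Sum>j<n. vec_index y j * vec_index y j) = N" by (simp add: N_def power2_eq_square)
    moreover have "(\<Sum>j<n. vec_index y (cyc n v j) * vec_index y j) =
        N - dirichlet n v (vec_index y) / 2" for v
      by (simp add: dirichlet_correlation[OF n] N_def)
    ultimately show ?thesis
      unfolding W_def u_equi_static_bilinear[OF u] sum.distrib[of _ _ "{..<n}"]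
      using n by (intro arg_cong2[where f = "(/)"] sum.cong refl) (simp only:, simp add: field_simps)
  qed
  also have "\<dots> = (M * (2 * N) - (real n - 1) / n * S) / (2 * M)"
    by (simp add: sum_subtractf sum_distrib_left S_def)
  also have "\<dots> = N - (real n - 1) / (2 * n * M) * S"
    using \<open>1 \<le> M\<close> n by (simp add: field_simps)
  finally show ?thesis using le by (simp add: N S_def W_def algebra_simps)
qed


section \<open>The random matrix\<close>

lemma ou_equi_dyn_carrier [simp]: "ou_equi_dyn n \<eta> v s \<in> carrier_mat n n"
  by (simp add: ou_equi_dyn_def ou_mat_def)

lemma ou_equi_dyn_index:
  assumes "i < n" "j < n"
  shows "ou_equi_dyn n \<eta> v s $$ (i, j) = (1 - \<eta>) * (if i = j then 1 else 0)
    + \<eta> * pairing_entry n (cyc n v) (proposers n v s) (i, j)"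
  using assms by (simp add: ou_equi_dyn_def ou_mat_eq)

lemma ou_equi_dyn_apply:
  assumes "k < n"
  shows "(\<Sum>l<n. ou_equi_dyn n \<eta> v s $$ (k, l) * z l) = (1 - \<eta>) * z k
    + \<eta> * (\<Sum>l<n. pairing_entry n (cyc n v) (proposers n v s) (k, l) * z l)"
proof -
  have "(\<Sum>l<n. ou_equi_dyn n \<eta> v s $$ (k, l) * z l) =
      (\<Sum>l<n. (if k = l then (1 - \<eta>) * z l else 0)
        + \<eta> * (pairing_entry n (cyc n v) (proposers n v s) (k, l) * z l))"
    using assms by (intro sum.cong refl) (simp add: ou_equi_dyn_index algebra_simps)
  thus ?thesis using assms by (simp add: sum.distrib sum_distrib_left)
qed

text \<open>A matched row of the pairing matrix carries 1/n and (n-1)/n, an unmatched row a single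
  1. This is what allows centring before applying the matrix.\<close>

lemma ou_equi_dyn_row_sum:
  assumes "0 < \<bar>v\<bar>" "\<bar>v\<bar> < int n" "k < n"
  shows "(\<Sum>l<n. ou_equi_dyn n \<eta> v s $$ (k, l)) = 1"
proof -
  let ?f = "cyc n v" and ?P = "proposers n v s"
  have n: "0 < n" using assms by simp
  have P: "?P \<subseteq> {..<n}" by (rule proposers_subset[OF n])
  have fP: "?f ` ?P \<subseteq> {..<n}" using cyc_less[OF n] by auto
  note sums = pairing_entry_sum[OF P fP proposers_matching[OF assms(1,2)] n, where z = "\<lambda>_. 1"]
  have "(\<Sum>l<n. pairing_entry n ?f ?P (k, l)) = 1"
  proof (cases "k \<in> ?P \<union> ?f ` ?P")
    case True
    thus ?thesis using sums(1,2) n by (auto simp: field_simps)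
  next
    case False
    thus ?thesis using sums(3)[OF assms(3)] by simp
  qed
  thus ?thesis using ou_equi_dyn_apply[OF assms(3), of \<eta> v s "\<lambda>_. 1"] by simp
qed

lemma ou_equi_dyn_norm:
  fixes \<eta> :: real
  assumes "0 < \<bar>v\<bar>" "\<bar>v\<bar> < int n" "x \<in> carrier_vec n"
  defines "y \<equiv> Pi_mat n *\<^sub>v x" and "c \<equiv> \<eta> * (real n - 1) / n"
  shows "(euclid_norm (Pi_mat n *\<^sub>v (ou_equi_dyn n \<eta> v s *\<^sub>v x)))\<^sup>2 \<le>
    (euclid_norm y)\<^sup>2 - 2 * c * (1 - c) *
      (\<Sum>p\<in>proposers n v s. (vec_index y p - vec_index y (cyc n v p))\<^sup>2)"
proof -
  let ?f = "cyc n v" and ?P = "proposers n v s" and ?W = "ou_equi_dyn n \<eta> v s"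
  have n: "0 < n" using assms by simp
  have y: "y \<in> carrier_vec n" unfolding y_def by (rule mult_mat_vec_carrier[OF Pi_mat_carrier assms(3)])
  have P: "?P \<subseteq> {..<n}" by (rule proposers_subset[OF n])
  have fP: "?f ` ?P \<subseteq> {..<n}" using cyc_less[OF n] by auto
  have "(euclid_norm (Pi_mat n *\<^sub>v (?W *\<^sub>v x)))\<^sup>2 \<le> (euclid_norm (?W *\<^sub>v y))\<^sup>2"
    unfolding y_def
    by (intro power_mono euclid_norm_nonneg Pi_mat_stochastic ou_equi_dyn_carrier assms(3) n
        ou_equi_dyn_row_sum[OF assms(1,2)])
  also have "\<dots> = (\<Sum>k<n. ((1 - \<eta>) * vec_index y k
      + \<eta> * (\<Sum>l<n. pairing_entry n ?f ?P (k, l) * vec_index y l))\<^sup>2)"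
    using carrier_matD[OF ou_equi_dyn_carrier[of n \<eta> v s]]
    by (simp add: euclid_norm_sq mult_mat_vec_index[OF ou_equi_dyn_carrier y] ou_equi_dyn_apply
        del: index_mult_mat_vec)
  also have "\<dots> = (\<Sum>k<n. (vec_index y k)\<^sup>2) - 2 * c * (1 - c) *
      (\<Sum>p\<in>?P. (vec_index y p - vec_index y (?f p))\<^sup>2)"
    unfolding c_def by (rule lazy_pairing_norm[OF P fP proposers_matching[OF assms(1,2)] n])
  finally show ?thesis using y by (simp add: euclid_norm_sq)
qed

lemma ou_equi_dyn_average:
  assumes v: "0 < \<bar>v\<bar>" "\<bar>v\<bar> < int n" and x: "x \<in> carrier_vec n" and "0 < \<eta>" "\<eta> < 1"
  defines "y \<equiv> Pi_mat n *\<^sub>v x"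
  shows "(\<Sum>s<n. (euclid_norm (Pi_mat n *\<^sub>v (ou_equi_dyn n \<eta> v s *\<^sub>v x)))\<^sup>2) / n \<le>
    (euclid_norm y)\<^sup>2 - 2 / 3 * \<eta> * (1 - \<eta>) * ((real n - 1) / n) * dirichlet n v (vec_index y)"
proof -
  define c where "c = \<eta> * (real n - 1) / n"
  define S where "S = dirichlet n v (vec_index y)"
  let ?C = "real (card (proposers n v 0))"
  have n: "0 < n" using v by simp
  have c: "0 \<le> c" "c \<le> \<eta>" using n assms(4) by (auto simp: c_def field_simps)
  have "(\<Sum>s<n. (euclid_norm (Pi_mat n *\<^sub>v (ou_equi_dyn n \<eta> v s *\<^sub>v x)))\<^sup>2) \<le>
      (\<Sum>s<n. (euclid_norm y)\<^sup>2 - 2 * c * (1 - c) *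
        (\<Sum>p\<in>proposers n v s. (vec_index y p - vec_index y (cyc n v p))\<^sup>2))"
    unfolding c_def y_def by (intro sum_mono ou_equi_dyn_norm v x)
  also have "\<dots> = n * (euclid_norm y)\<^sup>2 - 2 * c * (1 - c) * (?C * S)"
    by (simp add: sum_subtractf sum_distrib_left[symmetric] sum_proposers[OF n] S_def dirichlet_def)
  finally have le: "(\<Sum>s<n. (euclid_norm (Pi_mat n *\<^sub>v (ou_equi_dyn n \<eta> v s *\<^sub>v x)))\<^sup>2) \<le>
      n * (euclid_norm y)\<^sup>2 - 2 * c * (1 - c) * (?C * S)" .
  \<comment> \<open>Two estimates enter: at least \<open>n / 3\<close> proposers, and
    \<open>1 - c \<ge> 1 - \<eta>\<close> because \<open>c \<le> \<eta>\<close>. The factor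
    \<open>c\<close> stays exact, since its \<open>(real n - 1) / n\<close> reappears in the static
    quadratic form.\<close>
  have "2 * c * (1 - \<eta>) * (n / 3 * S) \<le> 2 * c * (1 - c) * (?C * S)"
    using c assms(5) card_proposers[OF n, of v] dirichlet_nonneg[of n v "vec_index y"]
    by (intro mult_mono mult_nonneg_nonneg) (auto simp: S_def)
  with le have "(\<Sum>s<n. (euclid_norm (Pi_mat n *\<^sub>v (ou_equi_dyn n \<eta> v s *\<^sub>v x)))\<^sup>2) \<le>
      n * (euclid_norm y)\<^sup>2 - 2 * c * (1 - \<eta>) * (n / 3 * S)" by linarith
  also have "\<dots> = ((euclid_norm y)\<^sup>2 - 2 / 3 * \<eta> * (1 - \<eta>) * ((real n - 1) / n) * S) * n"
    using n by (simp add: c_def field_simps)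
  finally show ?thesis using n by (simp add: S_def pos_divide_le_eq)
qed

section \<open>Expectation over the offset and the starting node\<close>

text \<open>The law of the offset weighs a value by its multiplicity; this converts back to a sum
  with repetitions, which can be indexed by \<open>m\<close>.\<close>

lemma sum_count_mult:
  fixes h :: "'a \<Rightarrow> real"
  shows "(\<Sum>v\<in>set_mset B. count B v * h v) = (\<Sum>v\<in>#B. h v)"
proof (induction B)
  case (add b B)
  have "(\<Sum>v\<in>set_mset (add_mset b B). count (add_mset b B) v * h v) =
      (\<Sum>v\<in>insert b (set_mset B). count B v * h v + (if v = b then h v else 0))"
    by (intro sum.cong) (auto simp: algebra_simps)
  also have "\<dots> = (\<Sum>v\<in>insert b (set_mset B). count B v * h v) + h b"
    by (simp add: sum.distrib)
  \<comment> \<open>If \<open>b\<close> is new, its count in \<open>B\<close> is zero, so adjoining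
    it to the index set adds nothing.\<close>
  also have "(\<Sum>v\<in>insert b (set_mset B). count B v * h v) = (\<Sum>v\<in>set_mset B. count B v * h v)"
    by (intro sum.mono_neutral_right) (auto simp: not_in_iff)
  finally show ?case using add by simp
qed simp

text \<open>Independence splits each weight into the multiplicity of the offset over
  \<open>2 * M\<close> and \<open>1 / n\<close> for the start. Both signs of \<open>u m\<close> stay
  together, since their energies agree.\<close>

lemma expectation_ou_equi_dyn_pmf:
  fixes g :: "real mat \<Rightarrow> real"
  assumes "0 < n" "1 \<le> M"
  shows "measure_pmf.expectation (ou_equi_dyn_pmf n M u \<eta>) g =
    (\<Sum>m\<in>{1..M}. (\<Sum>s<n. g (ou_equi_dyn n \<eta> (u m) s)) / n
      + (\<Sum>s<n. g (ou_equi_dyn n \<eta> (- int (u m)) s)) / n) / (2 * M)"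
proof -
  define B where "B = basis_index M u"
  define h where "h v = (\<Sum>s<n. g (ou_equi_dyn n \<eta> v s)) / n" for v
  have size: "size B = 2 * M" by (simp add: B_def basis_index_def)
  hence ne: "B \<noteq> {#}" using assms by auto
  let ?p = "pair_pmf (pmf_of_multiset B) (pmf_of_set {0..<n})"
  have "measure_pmf.expectation (ou_equi_dyn_pmf n M u \<eta>) g =
      measure_pmf.expectation ?p (\<lambda>(v, s). g (ou_equi_dyn n \<eta> v s))"
    by (simp add: ou_equi_dyn_pmf_def B_def case_prod_unfold)
  also have "\<dots> = (\<Sum>(v, s)\<in>set_mset B \<times> {..<n}. g (ou_equi_dyn n \<eta> v s) * pmf ?p (v, s))"
    using assms ne
    by (subst integral_measure_pmf_real[of "set_mset B \<times> {..<n}"])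
       (auto simp: case_prod_unfold lessThan_atLeast0)
  also have "\<dots> = (\<Sum>v\<in>set_mset B. \<Sum>s<n. g (ou_equi_dyn n \<eta> v s) * (count B v / size B / n))"
    using assms ne
    by (subst sum.cartesian_product[symmetric]) (auto intro!: sum.cong simp: pmf_pair)
  also have "\<dots> = (\<Sum>v\<in>set_mset B. count B v * h v) / size B"
    by (simp add: h_def sum_divide_distrib sum_distrib_left mult_ac)
  also have "(\<Sum>v\<in>set_mset B. count B v * h v) = (\<Sum>v\<in>#B. h v)"
    by (rule sum_count_mult)
  also have "\<dots> = (\<Sum>m\<in>{1..M}. h (u m) + h (- int (u m)))"
    by (simp add: B_def basis_index_def image_mset.compositionality comp_def sum.distrib
        sum_unfold_sum_mset[symmetric])
  finally show ?thesis by (simp add: size h_def)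
qed

theorem theorem4:
  fixes n M :: nat and u :: "nat \<Rightarrow> nat" and \<eta> \<rho> :: real
  assumes "n \<ge> 2" and "M \<ge> 1"
    and "\<forall>m\<in>{1..M}. u m \<in> {1..n - 1}"
    and "0 < \<eta>" and "\<eta> < 1"
    and "\<rho> = consensus_rate n (u_equi_static n M u)"
  shows "\<forall>x\<in>carrier_vec n.
    measure_pmf.expectation (ou_equi_dyn_pmf n M u \<eta>)
        (\<lambda>W. (euclid_norm (Pi_mat n *\<^sub>v (W *\<^sub>v x)))\<^sup>2)
      \<le> (1 - 4 / 3 * \<eta> * (1 - \<eta>) * (1 - \<rho>)) * (euclid_norm (Pi_mat n *\<^sub>v x))\<^sup>2"
proof
  fix x :: "real vec" assume x: "x \<in> carrier_vec n"
  define N where "N = (euclid_norm (Pi_mat n *\<^sub>v x))\<^sup>2"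
  define S where "S m = dirichlet n (int (u m)) (vec_index (Pi_mat n *\<^sub>v x))" for m
  \<comment> \<open>The factor in front of the energy in \<open>ou_equi_dyn_average\<close>.\<close>
  define k where "k = 2 / 3 * \<eta> * (1 - \<eta>) * ((real n - 1) / n)"
  define g where "g W = (euclid_norm (Pi_mat n *\<^sub>v (W *\<^sub>v x)))\<^sup>2" for W
  have n: "0 < n" using assms by simp
  have "(\<Sum>s<n. g (ou_equi_dyn n \<eta> (u m) s)) / n + (\<Sum>s<n. g (ou_equi_dyn n \<eta> (- int (u m)) s)) / n
      \<le> 2 * N - 2 * k * S m" if "m \<in> {1..M}" for m
  proof -
    have "0 < u m" "u m < n" using assms(1,3) that by force+
    thus ?thesis
      using ou_equi_dyn_average[of "int (u m)" n x \<eta>] ou_equi_dyn_average[of "- int (u m)" n x \<eta>]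
        x assms(4,5) dirichlet_uminus[OF n, of "int (u m)"]
      by (simp add: g_def N_def S_def k_def)
  qed
  hence "measure_pmf.expectation (ou_equi_dyn_pmf n M u \<eta>) g \<le> (\<Sum>m\<in>{1..M}. 2 * N - 2 * k * S m) / (2 * M)"
    unfolding expectation_ou_equi_dyn_pmf[OF n assms(2)]
    by (intro divide_right_mono sum_mono) auto
  also have "\<dots> = N - k / M * (\<Sum>m\<in>{1..M}. S m)"
    using assms(2) by (simp add: sum_subtractf sum_distrib_left[symmetric] diff_divide_distrib)
  \<comment> \<open>The static bound carries \<open>(real n - 1) / (2 * n * M)\<close>; splitting
    off its 2 turns the 2/3 in \<open>k\<close> into 4/3.\<close>
  also have "k / M * (\<Sum>m\<in>{1..M}. S m) =
      4 / 3 * \<eta> * (1 - \<eta>) * ((real n - 1) / (2 * n * M) * (\<Sum>m\<in>{1..M}. S m))"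
    using n assms(2) by (simp add: k_def field_simps)
  also have "N - \<dots> \<le> N - 4 / 3 * \<eta> * (1 - \<eta>) * ((1 - \<rho>) * N)"
    using dirichlet_ge_consensus[OF assms(3,2,1) x] assms(4,5)
    by (intro diff_left_mono mult_left_mono) (auto simp: S_def N_def assms(6))
  also have "\<dots> = (1 - 4 / 3 * \<eta> * (1 - \<eta>) * (1 - \<rho>)) * N"
    by (simp add: algebra_simps)
  finally show "measure_pmf.expectation (ou_equi_dyn_pmf n M u \<eta>)
        (\<lambda>W. (euclid_norm (Pi_mat n *\<^sub>v (W *\<^sub>v x)))\<^sup>2)
      \<le> (1 - 4 / 3 * \<eta> * (1 - \<eta>) * (1 - \<rho>)) * (euclid_norm (Pi_mat n *\<^sub>v x))\<^sup>2"
    unfolding g_def N_def .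
qed

end
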